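(* Consider the optimization problem of minimizing $f(x)=c(x)+\sum_{i=1}^Nf_i(x_i)$ subject to $g(x)\le0$ and $x\in X=X_1\times\cdots\times X_N$, where each $X_i\subset\mathbb{R}^{n_i}$ is non-empty, compact and convex, each $f_i$ and $c$ are convex and $C^2$, $g:\mathbb{R}^n\to\mathbb{R}^m$ is convex and $C^2$, and there is $\bar{x}\in X$ with $g(\bar{x})<0$. Fix regularization parameters $\kappa=(\alpha,\beta)$ with $\alpha\in(0,L_p)$ and $\beta>0$, and let $(\hat{x}_\kappa,\hat{\mu}_\kappa)$ be the unique saddle point of $L_\kappa$ over $X\times\mathbb{R}^m_+$. Consider a run of the asynchronous primal-dual algorithm described in the context, satisfying all the timing and communication requirements given there, and such that for every $t$ the sets $\{X^t(s)\}_{s\in\mathbb{N}}$ defined there satisfy properties (a)–(d) listed there. Let the primal step-size satisfy $\gamma\in(0,2/L_p)$. Then for the sequence $\{x^c_t\}_{t\in\mathbb{N}}$ of primal vectors aggregated by the cloud, $$\|x^c_t-\hat{x}_\kappa\|_2\le q_p^{c(t)}\sqrt{N}L_x+\frac{M_g}{\alpha}\|\mu(t)-\hat{\mu}_\kappa\|_2,$$ where $L_x:=\max_{1\le i\le N}\max_{x_i,y_i\in X_i}\|x_i-y_i\|$ and $M_g:=\max_{x\in X}\|\nabla g(x)\|$.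
   Context: **Notation.** $\|\cdot\|=\|\cdot\|_2$ is the Euclidean norm; $x=(x_1,\dots,x_N)$ with blocks $x_i\in\mathbb{R}^{n_i}$, $n=\sum_i n_i$; $\|x\|_{2,\infty}:=\max_i\|x_i\|_2$; $\Pi_S$ is Euclidean projection onto $S$. $L_\kappa(x,\mu)=f(x)+\frac{\alpha}{2}\|x\|^2+\mu^Tg(x)-\frac{\beta}{2}\|\mu\|^2$. With $f^*=\min_Xf$ and $\bar{x}$ a fixed Slater point, $$M=\Big\{\mu\in\mathbb{R}^m_+:\|\mu\|_1\le\frac{f(\bar{x})+\frac{\alpha}{2}\|\bar{x}\|^2-f^*}{\min_j\{-g_j(\bar{x})\}}\Big\}$$ (this set contains $\hat\mu_\kappa$). $L_p$ is the maximum over $\mu\in M$ of the Lipschitz constant of $\nabla_xL_\kappa(\cdot,\mu)$ on $X$. $q_p:=\max\{|1-\gamma\alpha|,|1-\gamma L_p|\}$, and $\hat{x}^t:=\arg\min_{x\in X}L_\kappa(x,\mu(t))$. **Algorithm.** There are $N$ agents and a cloud. Agent $i$ stores a vector $x^i=(x^i_1,\dots,x^i_N)$; $x^i(k;t)$ is its value at time $k\in K=\mathbb{N}$ when the dual vector onboard is $\mu(t)$, $t\in T=\mathbb{N}$. Agent $j\ne i$ is an essential neighbor of agent $i$ ($j\in\mathcal{N}_i$) if $\nabla_{x_j}L_\kappa$ depends on $x_i$; only essential neighbors communicate with each other (blocks $x^i_j$ with $j\notin\mathcal{N}_i$ do not influence agent $i$'s updates, and one proceeds as though each agent stores a full state vector).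 All agents and the cloud are initialized with $x(0)\in X$, $\mu(0)\in M$. Let $K^i\subset K$ be the set of times at which agent $i$ computes updates. Then $x^i_i(k+1;t)=\Pi_{X_i}[x^i_i(k;t)-\gamma\nabla_{x_i}L_\kappa(x^i(k;t),\mu(t))]$ if $k\in K^i$, and $x^i_i(k+1;t)=x^i_i(k;t)$ otherwise. For $j\ne i$, $x^i_j(k+1;t)=x^j_j(\tau^i_j(k+1);t)$ if agent $i$ receives agent $j$'s state at time $k+1$, and $x^i_j(k+1;t)=x^i_j(k;t)$ otherwise; here $\tau^i_j(k)\le k$ is the time at which the value $x^i_j(k;t)$ was originally computed by agent $j$. Agents send their own blocks to essential neighbors and to the cloud at arbitrary times. With $\tau^c_i(t)$ the time at which agent $i$ computed the state it most recently sent to the cloud, the cloud forms $x^c_t=(x^1_1(\tau^c_1(t);t),\dots,x^N_N(\tau^c_N(t);t))$. After every agent has sent it a state computed with $\mu(t)$ onboard, the cloud computes $\mu(t+1)=\Pi_M[\mu(t)+\rho(g(x^c_t)-\beta\mu(t))]$ (with dual step-size $\rho$) and sends it to all agents, which continue from the states they currently hold. **Timing and communication requirements.** Each $K^i$ and $T$ are infinite; for any sequence $k_d\to\infty$ in $K^i$, $\tau^i_j(k_d)\to\infty$ for all $j\in\mathcal{N}_i$; for $t_d\to\infty$ in $T$, $\tau^c_i(t_d)\to\infty$ for all $i$. Each $\mu(t+1)$ sent by the cloud arrives in finite time. A transmission between agents sent while $\mu(t)$ is onboard is used only if received before $\mu(t+1)$. All transmissions arrive in the order sent. There is an increasing sequence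 of times $\{k_t\}_{t\in T}$ such that only $\mu(t)$ is used in the agents' updates at times $k_t\le k<k_{t+1}$; all agents receive $\mu(t)$ simultaneously at time $k_t$. **Sets.** $D(k_t):=\max_i\|x^i(k_t;t)-\hat{x}^t\|_{2,\infty}$ and $X^t(s)=\{y\in X:\|y-\hat{x}^t\|_{2,\infty}\le q_p^sD(k_t)\}$. Properties: (a) $\cdots\subset X^t(s+1)\subset X^t(s)\subset\cdots\subset X$; (b) $\lim_{s\to\infty}X^t(s)=\{\hat{x}^t\}$; (c) $X^t(s)=X^t_1(s)\times\cdots\times X^t_N(s)$ for some $X^t_i(s)\subset X_i$; (d) for all $y\in X^t(s)$ and all $i$, $\Pi_{X_i}[y_i-\gamma\nabla_{x_i}L_\kappa(y,\mu(t))]\in X^t_i(s+1)$. **Cycles.** After all agents have just received $\mu(t)$, the first cycle ends as soon as (i) each agent has computed a state update and (ii) each agent has sent that updated state to all of its essential neighbors and it has been received by them. Each subsequent cycle is completed when the preceding one has ended and (i), (ii) are met again. $c(t)$ is the number of cycles completed with $\mu(t)$ onboard before the first agent sends its state to the cloud for use in computing $\mu(t+1)$. *)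

theory Defs
  imports "HOL-Analysis.Analysis"
begin

definition C2 :: "('b::real_normed_vector \<Rightarrow> 'c::real_normed_vector) \<Rightarrow> bool" where
  "C2 F \<longleftrightarrow> (\<exists>(F' :: 'b \<Rightarrow> 'b \<Rightarrow>\<^sub>L 'c) (F'' :: 'b \<Rightarrow> 'b \<Rightarrow>\<^sub>L ('b \<Rightarrow>\<^sub>L 'c)).
     (\<forall>x. (F has_derivative blinfun_apply (F' x)) (at x)) \<and>
     (\<forall>x. (F' has_derivative blinfun_apply (F'' x)) (at x)) \<and>
     continuous_on UNIV F'')"

definition grad :: "('b::real_inner \<Rightarrow> real) \<Rightarrow> 'b \<Rightarrow> 'b" where
  "grad F x = (THE D. GDERIV F x :> D)"

definition lip_const :: "'b::metric_space set \<Rightarrow> ('b \<Rightarrow> 'c::metric_space) \<Rightarrow> real" where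
  "lip_const S F = Inf {C. C-lipschitz_on S F}"

definition nonneg_orthant :: "(real ^ 'm) set" where
  "nonneg_orthant = {\<mu>. \<forall>j. 0 \<le> \<mu> $ j}"

text \<open>
  The agents are the elements of a finite type \<open>'a\<close>, so that \<open>N = CARD('a)\<close>, and
  \<open>blk l\<close> is the agent whose block contains the coordinate \<open>l\<close>. The space of dimension
  \<open>n\<^sub>i\<close> = (number of coordinates \<open>l\<close> with \<open>blk l = i\<close>) is represented by the subspace
  \<open>block_space\<close> of vectors that vanish outside block \<open>i\<close>; the sets \<open>Xi i\<close> live there,
  and \<open>fi i\<close> is only ever evaluated there.
\<close>

record ('n::finite, 'm::finite, 'a) problem =
  blk :: "'n \<Rightarrow> 'a"
  Xi :: "'a \<Rightarrow> (real ^ 'n) set"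
  cost :: "real ^ 'n \<Rightarrow> real"
  fi :: "'a \<Rightarrow> real ^ 'n \<Rightarrow> real"
  constr :: "real ^ 'n \<Rightarrow> real ^ 'm"
  slater :: "real ^ 'n"
  alpha :: real
  beta :: real

definition block_space :: "('n::finite, 'm::finite, 'a::finite) problem \<Rightarrow> 'a \<Rightarrow> (real ^ 'n) set" where
  "block_space P i = {x. \<forall>l. blk P l \<noteq> i \<longrightarrow> x $ l = 0}"

definition block :: "('n::finite, 'm::finite, 'a::finite) problem \<Rightarrow> 'a \<Rightarrow> real ^ 'n \<Rightarrow> real ^ 'n" where
  "block P i x = (\<chi> l. if blk P l = i then x $ l else 0)"

definition block_product ::
  "('n::finite, 'm::finite, 'a::finite) problem \<Rightarrow> ('a \<Rightarrow> (real ^ 'n) set) \<Rightarrow> (real ^ 'n) set" where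
  "block_product P Y = {x. \<forall>i. block P i x \<in> Y i}"

definition X :: "('n::finite, 'm::finite, 'a::finite) problem \<Rightarrow> (real ^ 'n) set" where
  "X P = block_product P (Xi P)"

definition norm_2inf :: "('n::finite, 'm::finite, 'a::finite) problem \<Rightarrow> real ^ 'n \<Rightarrow> real" where
  "norm_2inf P x = (MAX i. norm (block P i x))"

definition objective :: "('n::finite, 'm::finite, 'a::finite) problem \<Rightarrow> real ^ 'n \<Rightarrow> real" where
  "objective P x = cost P x + (\<Sum>i\<in>UNIV. fi P i (block P i x))"

definition convex_problem :: "('n::finite, 'm::finite, 'a::finite) problem \<Rightarrow> bool" where
  "convex_problem P \<longleftrightarrow>
     (\<forall>i. Xi P i \<subseteq> block_space P i \<and> Xi P i \<noteq> {} \<and> compact (Xi P i) \<and> convex (Xi P i)) \<and>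
     convex_on UNIV (cost P) \<and> C2 (cost P) \<and>
     (\<forall>i. convex_on (block_space P i) (fi P i) \<and> C2 (\<lambda>x. fi P i (block P i x))) \<and>
     (\<forall>j. convex_on UNIV (\<lambda>x. constr P x $ j)) \<and> C2 (constr P) \<and>
     slater P \<in> X P \<and> (\<forall>j. constr P (slater P) $ j < 0)"

definition Lagr :: "('n::finite, 'm::finite, 'a::finite) problem \<Rightarrow> real ^ 'n \<Rightarrow> real ^ 'm \<Rightarrow> real" where
  "Lagr P x \<mu> = objective P x + alpha P / 2 * (norm x)\<^sup>2 + \<mu> \<bullet> constr P x - beta P / 2 * (norm \<mu>)\<^sup>2"

definition grad_Lagr ::
  "('n::finite, 'm::finite, 'a::finite) problem \<Rightarrow> real ^ 'n \<Rightarrow> real ^ 'm \<Rightarrow> real ^ 'n" where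
  "grad_Lagr P x \<mu> = grad (\<lambda>z. Lagr P z \<mu>) x"

definition saddle_point ::
  "('n::finite, 'm::finite, 'a::finite) problem \<Rightarrow> real ^ 'n \<Rightarrow> real ^ 'm \<Rightarrow> bool" where
  "saddle_point P x \<mu> \<longleftrightarrow> x \<in> X P \<and> \<mu> \<in> nonneg_orthant \<and>
     (\<forall>\<nu>\<in>nonneg_orthant. Lagr P x \<nu> \<le> Lagr P x \<mu>) \<and>
     (\<forall>y\<in>X P. Lagr P x \<mu> \<le> Lagr P y \<mu>)"

definition dual_set :: "('n::finite, 'm::finite, 'a::finite) problem \<Rightarrow> (real ^ 'm) set" where
  "dual_set P = {\<mu> \<in> nonneg_orthant.
     (\<Sum>j\<in>UNIV. \<bar>\<mu> $ j\<bar>) \<le>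
       (objective P (slater P) + alpha P / 2 * (norm (slater P))\<^sup>2 - (INF x\<in>X P. objective P x))
         / (MIN j. - (constr P (slater P) $ j))}"

definition L_p :: "('n::finite, 'm::finite, 'a::finite) problem \<Rightarrow> real" where
  "L_p P = (SUP \<mu>\<in>dual_set P. lip_const (X P) (\<lambda>x. grad_Lagr P x \<mu>))"

definition q_p :: "('n::finite, 'm::finite, 'a::finite) problem \<Rightarrow> real \<Rightarrow> real" where
  "q_p P \<gamma> = max \<bar>1 - \<gamma> * alpha P\<bar> \<bar>1 - \<gamma> * L_p P\<bar>"

definition L_x :: "('n::finite, 'm::finite, 'a::finite) problem \<Rightarrow> real" where
  "L_x P = (MAX i. diameter (Xi P i))"

text \<open>
  The norm of the Jacobian matrix is the one induced by the Euclidean norms (the operator norm),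
  not the Frobenius norm that \<^const>\<open>norm\<close> would give on matrices.
\<close>

definition M_g :: "('n::finite, 'm::finite, 'a::finite) problem \<Rightarrow> real" where
  "M_g P = (SUP x\<in>X P. onorm (frechet_derivative (constr P) (at x)))"

text \<open>Agent \<open>j\<close> is in \<open>ess_nbrs P i\<close> if the block-\<open>j\<close> gradient of the Lagrangian depends on
  block \<open>i\<close>.\<close>

definition ess_nbrs :: "('n::finite, 'm::finite, 'a::finite) problem \<Rightarrow> 'a \<Rightarrow> 'a set" where
  "ess_nbrs P i = {j. j \<noteq> i \<and> (\<exists>x y. \<exists>\<mu>\<in>nonneg_orthant. (\<forall>l. l \<noteq> i \<longrightarrow> block P l x = block P l y) \<and>
     block P j (grad_Lagr P x \<mu>) \<noteq> block P j (grad_Lagr P y \<mu>))}"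

text \<open>
  \<open>gam\<close> and \<open>rho\<close> are the primal and dual step sizes, \<open>upd i\<close> is the set of times
  at which agent \<open>i\<close> computes updates, \<open>mu t\<close> the dual vectors, and \<open>kt t\<close> the time at
  which all agents receive \<open>mu t\<close>. The dual vector onboard at time \<open>k\<close> is thus the one with
  \<open>kt t \<le> k < kt (Suc t)\<close>, so a single time index suffices: \<open>st i k\<close> is the full vector held
  by agent \<open>i\<close> at time \<open>k\<close>.

  A pair \<open>(s, r) \<in> tx i j\<close> is a transmission from agent \<open>i\<close> to agent \<open>j\<close>: at time
  \<open>s\<close> agent \<open>i\<close> sends its own block, which arrives at time \<open>r\<close>. Likewise \<open>ctx i\<close>
  contains the transmissions from agent \<open>i\<close> to the cloud. The cloud computes \<open>mu (Suc t)\<close>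
  at time \<open>ct t\<close>.
\<close>

record ('n::finite, 'm::finite, 'a) run =
  gam :: real
  rho :: real
  upd :: "'a \<Rightarrow> nat set"
  kt :: "nat \<Rightarrow> nat"
  ct :: "nat \<Rightarrow> nat"
  tx :: "'a \<Rightarrow> 'a \<Rightarrow> (nat \<times> nat) set"
  ctx :: "'a \<Rightarrow> (nat \<times> nat) set"
  st :: "'a \<Rightarrow> nat \<Rightarrow> real ^ 'n"
  mu :: "nat \<Rightarrow> real ^ 'm"

text \<open>The time at which agent \<open>i\<close> computed the own block it holds at time \<open>k\<close>: an update
  computed at time \<open>l\<close> produces the value indexed by \<open>Suc l\<close>, and the initial value counts as
  computed at time 0.\<close>

definition comp_time :: "('n::finite, 'm::finite, 'a::finite) run \<Rightarrow> 'a \<Rightarrow> nat \<Rightarrow> nat" where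
  "comp_time R i k = Max (insert 0 {Suc l | l. l \<in> upd R i \<and> l < k})"

text \<open>\<open>used R j i s r\<close>: agent \<open>i\<close> receives at time \<open>r\<close>, and uses, the state that agent
  \<open>j\<close> sent at time \<open>s\<close>. It is discarded if a new dual vector arrives in between.\<close>

definition used ::
  "('n::finite, 'm::finite, 'a::finite) run \<Rightarrow> 'a \<Rightarrow> 'a \<Rightarrow> nat \<Rightarrow> nat \<Rightarrow> bool" where
  "used R j i s r \<longleftrightarrow> (s, r) \<in> tx R j i \<and> (\<exists>t. kt R t \<le> s \<and> r < kt R (Suc t))"

text \<open>\<open>tau R i j k\<close> is the time at which agent \<open>j\<close> computed the value of its block that agent
  \<open>i\<close> holds at time \<open>k\<close>. As transmissions arrive in the order sent, this value stems from the
  latest-sent one used so far.\<close>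

definition tau :: "('n::finite, 'm::finite, 'a::finite) run \<Rightarrow> 'a \<Rightarrow> 'a \<Rightarrow> nat \<Rightarrow> nat" where
  "tau R i j k = comp_time R j (Max (insert 0 {s. \<exists>r\<le>k. used R j i s r}))"

text \<open>The time at which agent \<open>i\<close> sent the state that the cloud uses for \<open>mu (Suc t)\<close>.\<close>

definition cloud_send :: "('n::finite, 'm::finite, 'a::finite) run \<Rightarrow> 'a \<Rightarrow> nat \<Rightarrow> nat" where
  "cloud_send R i t = Max {s. \<exists>r\<le>ct R t. (s, r) \<in> ctx R i}"

definition tau_c :: "('n::finite, 'm::finite, 'a::finite) run \<Rightarrow> 'a \<Rightarrow> nat \<Rightarrow> nat" where
  "tau_c R i t = comp_time R i (cloud_send R i t)"

definition x_c ::
  "('n::finite, 'm::finite, 'a::finite) problem \<Rightarrow> ('n, 'm, 'a) run \<Rightarrow> nat \<Rightarrow> real ^ 'n" where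
  "x_c P R t = (\<Sum>i\<in>UNIV. block P i (st R i (tau_c R i t)))"

definition ordered_transmissions :: "(nat \<times> nat) set \<Rightarrow> bool" where
  "ordered_transmissions A \<longleftrightarrow>
     (\<forall>(s, r)\<in>A. s \<le> r) \<and> (\<forall>(s, r)\<in>A. \<forall>(s', r')\<in>A. s < s' \<longrightarrow> r \<le> r')"

definition communication ::
  "('n::finite, 'm::finite, 'a::finite) problem \<Rightarrow> ('n, 'm, 'a) run \<Rightarrow> bool" where
  "communication P R \<longleftrightarrow>
     (\<forall>i. infinite (upd R i)) \<and>
     strict_mono (kt R) \<and> kt R 0 = 0 \<and>
     (\<forall>i j. ordered_transmissions (tx R i j)) \<and>
     (\<forall>i j. tx R i j \<noteq> {} \<longrightarrow> j \<in> ess_nbrs P i) \<and>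
     (\<forall>i. ordered_transmissions (ctx R i)) \<and>
     \<comment> \<open>by time \<open>ct R t\<close> the cloud has a state computed with \<open>mu R t\<close> from every agent\<close>
     (\<forall>t i. \<exists>(s, r)\<in>ctx R i. r \<le> ct R t \<and> kt R t < comp_time R i s) \<and>
     (\<forall>t. ct R t \<le> kt R (Suc t)) \<and>
     (\<forall>i. \<forall>j\<in>ess_nbrs P i. \<forall>kd. (\<forall>d. kd d \<in> upd R i) \<and> filterlim kd at_top sequentially \<longrightarrow>
        filterlim (\<lambda>d. tau R i j (kd d)) at_top sequentially) \<and>
     (\<forall>i. \<forall>td. filterlim td at_top sequentially \<longrightarrow>
        filterlim (\<lambda>d. tau_c R i (td d)) at_top sequentially)"

definition primal_step ::
  "('n::finite, 'm::finite, 'a::finite) problem \<Rightarrow> real \<Rightarrow> 'a \<Rightarrow> real ^ 'n \<Rightarrow> real ^ 'm \<Rightarrow> real ^ 'n" where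
  "primal_step P \<gamma> i y \<mu> =
     closest_point (Xi P i) (block P i y - \<gamma> *\<^sub>R block P i (grad_Lagr P y \<mu>))"

definition iterates ::
  "('n::finite, 'm::finite, 'a::finite) problem \<Rightarrow> ('n, 'm, 'a) run \<Rightarrow> bool" where
  "iterates P R \<longleftrightarrow>
     (\<exists>x0\<in>X P. \<forall>i. st R i 0 = x0) \<and>
     mu R 0 \<in> dual_set P \<and>
     (\<forall>t k i. kt R t \<le> k \<and> k < kt R (Suc t) \<longrightarrow>
        block P i (st R i (Suc k)) =
          (if k \<in> upd R i then primal_step P (gam R) i (st R i k) (mu R t)
           else block P i (st R i k))) \<and>
     (\<forall>k i j. j \<noteq> i \<longrightarrow>
        block P j (st R i (Suc k)) =
          (if \<exists>s. used R j i s (Suc k) then block P j (st R j (tau R i j (Suc k)))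
           else block P j (st R i k))) \<and>
     (\<forall>t. mu R (Suc t) =
        closest_point (dual_set P) (mu R t + rho R *\<^sub>R (constr P (x_c P R t) - beta P *\<^sub>R mu R t)))"

definition async_run ::
  "('n::finite, 'm::finite, 'a::finite) problem \<Rightarrow> ('n, 'm, 'a) run \<Rightarrow> bool" where
  "async_run P R \<longleftrightarrow> communication P R \<and> iterates P R"

definition x_hat ::
  "('n::finite, 'm::finite, 'a::finite) problem \<Rightarrow> ('n, 'm, 'a) run \<Rightarrow> nat \<Rightarrow> real ^ 'n" where
  "x_hat P R t = arg_min_on (\<lambda>x. Lagr P x (mu R t)) (X P)"

definition D_max ::
  "('n::finite, 'm::finite, 'a::finite) problem \<Rightarrow> ('n, 'm, 'a) run \<Rightarrow> nat \<Rightarrow> real" where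
  "D_max P R t = (MAX i. norm_2inf P (st R i (kt R t) - x_hat P R t))"

definition Xset ::
  "('n::finite, 'm::finite, 'a::finite) problem \<Rightarrow> ('n, 'm, 'a) run \<Rightarrow> nat \<Rightarrow> nat \<Rightarrow> (real ^ 'n) set" where
  "Xset P R t s = {y \<in> X P. norm_2inf P (y - x_hat P R t) \<le> q_p P (gam R) ^ s * D_max P R t}"

text \<open>The second condition is set-theoretic convergence: the lower and the upper limit of the sequence
  of sets agree and equal the singleton.\<close>

definition contracting_sets ::
  "('n::finite, 'm::finite, 'a::finite) problem \<Rightarrow> ('n, 'm, 'a) run \<Rightarrow> nat \<Rightarrow> bool" where
  "contracting_sets P R t \<longleftrightarrow>
     (\<forall>s. Xset P R t (Suc s) \<subseteq> Xset P R t s \<and> Xset P R t s \<subseteq> X P) \<and>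
     (Liminf sequentially (Xset P R t) = {x_hat P R t} \<and>
      Limsup sequentially (Xset P R t) = {x_hat P R t}) \<and>
     (\<exists>Y :: nat \<Rightarrow> 'a \<Rightarrow> (real ^ 'n) set.
        (\<forall>s i. Y s i \<subseteq> Xi P i) \<and>
        (\<forall>s. Xset P R t s = block_product P (Y s)) \<and>
        (\<forall>s. \<forall>y\<in>Xset P R t s. \<forall>i. primal_step P (gam R) i y (mu R t) \<in> Y (Suc s) i))"

text \<open>
  \<open>cycle_met P R a e\<close>: at time \<open>e\<close>, every agent has computed an update at some time \<open>\<ge> a\<close>
  (so that the resulting state has computation time \<open>p > a\<close>) and has sent the state so obtained
  to all its essential neighbors, which have received it.
\<close>

definition cycle_met ::
  "('n::finite, 'm::finite, 'a::finite) problem \<Rightarrow> ('n, 'm, 'a) run \<Rightarrow> nat \<Rightarrow> nat \<Rightarrow> bool" where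
  "cycle_met P R a e \<longleftrightarrow>
     (\<forall>i. \<exists>k\<in>upd R i. a \<le> k \<and> Suc k \<le> e \<and>
        (\<forall>j\<in>ess_nbrs P i. \<exists>(s, r)\<in>tx R i j. comp_time R i s = Suc k \<and> r \<le> e))"

text \<open>\<open>cycle_end P R t n e\<close>: the \<open>n\<close>-th cycle with \<open>mu R t\<close> onboard ends at time \<open>e\<close>.\<close>

inductive cycle_end ::
  "('n::finite, 'm::finite, 'a::finite) problem \<Rightarrow> ('n, 'm, 'a) run \<Rightarrow> nat \<Rightarrow> nat \<Rightarrow> nat \<Rightarrow> bool"
  for P R t where
  start: "cycle_end P R t 0 (kt R t)"
| step: "cycle_end P R t n a \<Longrightarrow> cycle_met P R a e \<Longrightarrow> (\<forall>e'<e. \<not> cycle_met P R a e') \<Longrightarrow>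
    cycle_end P R t (Suc n) e"

text \<open>Arrivals at a time \<open>k\<close> are already part of the states at time \<open>k\<close>, hence of what is sent at
  time \<open>k\<close>. So a cycle ending at the very time of the first transmission to the cloud counts.\<close>

definition cycles ::
  "('n::finite, 'm::finite, 'a::finite) problem \<Rightarrow> ('n, 'm, 'a) run \<Rightarrow> nat \<Rightarrow> nat" where
  "cycles P R t = card {n. 1 \<le> n \<and> (\<exists>e \<le> (MIN i. cloud_send R i t). cycle_end P R t n e)}"

end

theory Submission
  imports Defs
begin

text \<open>
  The point \<^term>\<open>x_hat P R t\<close>, which minimises the Lagrangian for the multiplier
  \<^term>\<open>mu R t\<close> onboard, splits the error into two parts.

  \<^emph>\<open>Distance from the aggregated vector to the current minimiser.\<close> The sets
  \<^term>\<open>Xset P R t s\<close> are boxes, products of one set per block, and a projected gradient step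
  evaluated anywhere in the \<open>s\<close>-th box lands in the \<open>(s+1)\<close>-st. Since membership in a box is
  tested block by block, it does not matter that an agent mixes blocks of different ages, as long
  as each of them is in the box. If from time \<open>a\<close> on all blocks that
  influence an update lie in box \<open>s\<close>, then every own block updated after \<open>a\<close> lies in box
  \<open>s+1\<close> and stays there; a cycle that starts at \<open>a\<close> is over only when every agent has made such
  an update and all those who depend on it have received it. Every cycle thus gains one box
  (\<open>settled_cycle\<close>), and as the cloud collects its blocks after \<^term>\<open>cycles P R t\<close> cycles, the
  aggregated vector lies in the box of that index (\<open>x_c_in_Xset\<close>). The radius of box \<open>s\<close> is
  \<^term>\<open>q_p P (gam R) ^ s\<close> times that of box \<open>0\<close>, which is at most \<^term>\<open>L_x P\<close>
  because all agents hold feasible vectors, and passing from the block-maximum norm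
  to the Euclidean norm costs the factor \<open>sqrt N\<close>.

  Blocks from agents that are not essential neighbours are never refreshed, so the
  vector held by an agent need not be in any box of positive index. As these blocks do not enter
  the partial gradient used by the agent, they can be replaced by the blocks of
  \<^term>\<open>x_hat P R t\<close> without changing the update (\<open>primal_step_cong\<close>).

  \<^emph>\<open>Distance between the two minimisers.\<close> The saddle point \<open>x_kappa\<close> minimises the Lagrangian
  for \<open>mu_kappa\<close>. By strong convexity each minimiser undercuts the other one by
  \<open>\<alpha>/2\<close> times their squared distance; adding the two inequalities leaves the difference of
  the multipliers paired with the difference of the constraint values, which the Lipschitz
  constant \<^term>\<open>M_g P\<close> controls (\<open>minimiser_sensitivity\<close>).
\<close>

section \<open>Block decomposition\<close>

lemma block_nth: "block P i x $ l = (if blk P l = i then x $ l else 0)"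
  by (simp add: block_def)

lemma linear_block: "linear (block P i)"
  by (rule linearI) (simp_all add: vec_eq_iff block_nth)

lemma bounded_linear_block: "bounded_linear (block P i)"
  using linear_block linear_conv_bounded_linear by blast

lemma block_diff: "block P i (x - y) = block P i x - block P i y"
  using linear_block by (rule linear_diff)

text \<open>Vectors can be assembled from independently chosen blocks; this is how blocks are
  exchanged between vectors below.\<close>

lemma block_glue: "block P i (\<Sum>j\<in>UNIV. block P j (y j)) = block P i (y i)"
proof -
  have "(\<Sum>j\<in>UNIV. block P j (y j)) $ l = y (blk P l) $ l" for l
    by (simp add: block_nth)
  then show ?thesis by (simp add: vec_eq_iff block_nth)
qed

lemma block_eqI:
  assumes "\<And>i. block P i x = block P i y"
  shows "x = y"
proof -
  have "x $ l = y $ l" for l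
    using arg_cong[OF assms[of "blk P l"], of "\<lambda>v. v $ l"] by (simp add: block_nth)
  then show ?thesis by (simp add: vec_eq_iff)
qed

lemma block_of_block_space: "x \<in> block_space P i \<Longrightarrow> block P i x = x"
  by (auto simp: block_space_def vec_eq_iff block_nth)

lemma norm_squared_blocks: "(norm x)\<^sup>2 = (\<Sum>i\<in>UNIV. (norm (block P i x))\<^sup>2)"
proof -
  have "(\<Sum>i\<in>UNIV. (norm (block P i x))\<^sup>2)
      = (\<Sum>i\<in>UNIV. \<Sum>l\<in>UNIV. if blk P l = i then x $ l * x $ l else 0)"
    unfolding power2_norm_eq_inner inner_vec_def
    by (intro sum.cong refl) (simp add: block_nth)
  also have "\<dots> = (\<Sum>l\<in>UNIV. \<Sum>i\<in>UNIV. if blk P l = i then x $ l * x $ l else 0)"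
    by (rule sum.swap)
  also have "\<dots> = (norm x)\<^sup>2"
    unfolding power2_norm_eq_inner by (simp add: inner_vec_def)
  finally show ?thesis by simp
qed

lemma norm_block_le_norm_2inf: "norm (block P i x) \<le> norm_2inf P x"
  unfolding norm_2inf_def by (rule Max_ge) auto

lemma norm_2inf_leI: "(\<And>i. norm (block P i x) \<le> r) \<Longrightarrow> norm_2inf P x \<le> r"
  unfolding norm_2inf_def by (subst Max_le_iff) auto

lemma norm_2inf_nonneg: "0 \<le> norm_2inf P x"
  using norm_block_le_norm_2inf[of P undefined x] norm_ge_zero order_trans by blast

lemma norm_le_norm_2inf:
  fixes P :: "('n::finite, 'm::finite, 'a::finite) problem"
  shows "norm x \<le> sqrt (real CARD('a)) * norm_2inf P x"
proof (rule power2_le_imp_le)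
  have "(norm x)\<^sup>2 \<le> (\<Sum>i\<in>(UNIV::'a set). (norm_2inf P x)\<^sup>2)"
    unfolding norm_squared_blocks[of x P]
    by (intro sum_mono power_mono norm_block_le_norm_2inf) auto
  then show "(norm x)\<^sup>2 \<le> (sqrt (real CARD('a)) * norm_2inf P x)\<^sup>2"
    by (simp add: power_mult_distrib)
qed (simp add: norm_2inf_nonneg)

section \<open>The feasible sets\<close>

lemma compact_X:
  assumes "convex_problem P"
  shows "compact (X P)"
proof -
  have Xi: "compact (Xi P i)" for i
    using assms by (simp add: convex_problem_def)
  have "X P = (\<Inter>i. block P i -` Xi P i)"
    by (auto simp: X_def block_product_def)
  moreover have "closed (block P i -` Xi P i)" for i
    by (intro closed_vimage compact_imp_closed Xi linear_continuous_on bounded_linear_block)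
  ultimately have "closed (X P)" by auto
  moreover have "bounded (X P)"
  proof -
    have "\<forall>i. \<exists>r. \<forall>x\<in>Xi P i. norm x \<le> r"
      using Xi compact_imp_bounded bounded_iff by metis
    then obtain r where r: "norm x \<le> r i" if "x \<in> Xi P i" for i x by metis
    have "(norm x)\<^sup>2 \<le> (\<Sum>i\<in>UNIV. (r i)\<^sup>2)" if "x \<in> X P" for x
      unfolding norm_squared_blocks[of x P]
      using that by (intro sum_mono power_mono r) (auto simp: X_def block_product_def)
    then show ?thesis
      unfolding bounded_iff by (meson norm_ge_zero real_le_rsqrt)
  qed
  ultimately show ?thesis by (simp add: compact_eq_bounded_closed)
qed

lemma convex_X:
  assumes "convex_problem P"
  shows "convex (X P)"
proof -
  have "X P = (\<Inter>i. block P i -` Xi P i)"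
    by (auto simp: X_def block_product_def)
  moreover have "convex (block P i -` Xi P i)" for i
    using assms by (intro convex_linear_vimage linear_block) (simp add: convex_problem_def)
  ultimately show ?thesis by (simp add: convex_INT)
qed

lemma X_nonempty: "convex_problem P \<Longrightarrow> X P \<noteq> {}"
  by (auto simp: convex_problem_def)

lemma closed_dual_set: "closed (dual_set P)"
proof -
  have "closed (nonneg_orthant :: (real ^ 'm) set)"
    unfolding nonneg_orthant_def by (intro closed_Collect_all closed_Collect_le continuous_intros)
  then show ?thesis
    unfolding dual_set_def
    by (subst Collect_conj_eq, subst Collect_mem_eq)
       (intro closed_Int closed_Collect_le continuous_intros)
qed

text \<open>The multipliers stay in the dual set because they are projected onto it; the initial one
  shows that there is something to project onto. Nonnegativity is what makes the Lagrangian
  convex in the primal variable.\<close>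

lemma mu_nonneg:
  assumes "iterates P R"
  shows "mu R t \<in> nonneg_orthant"
proof -
  have "mu R 0 \<in> dual_set P" using assms by (simp add: iterates_def)
  moreover have "mu R (Suc t) \<in> dual_set P" for t
  proof -
    have "mu R (Suc t) =
        closest_point (dual_set P) (mu R t + rho R *\<^sub>R (constr P (x_c P R t) - beta P *\<^sub>R mu R t))"
      using assms by (simp add: iterates_def)
    moreover have "dual_set P \<noteq> {}"
      using \<open>mu R 0 \<in> dual_set P\<close> by auto
    ultimately show ?thesis
      by (simp add: closest_point_in_set closed_dual_set)
  qed
  ultimately have "mu R t \<in> dual_set P" by (cases t) auto
  then show ?thesis by (simp add: dual_set_def)
qed

section \<open>Sensitivity of the regularised minimiser to the multiplier\<close>

lemma C2_continuous: "C2 F \<Longrightarrow> continuous_on S F"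
  unfolding C2_def by (meson differentiable_def differentiable_imp_continuous_on
      differentiable_at_imp_differentiable_on)

lemma convex_on_finite_sum:
  assumes "finite I" "convex S" "\<And>i. i \<in> I \<Longrightarrow> convex_on S (F i)"
  shows "convex_on S (\<lambda>x. \<Sum>i\<in>I. F i x)"
  using assms by (induction I) (auto intro: convex_on_add simp: convex_on_const)

lemma convex_on_objective_plus_constraints:
  assumes P: "convex_problem P" and \<mu>: "\<mu> \<in> nonneg_orthant"
  shows "convex_on UNIV (\<lambda>x. objective P x + \<mu> \<bullet> constr P x)"
proof -
  have "convex_on UNIV (\<lambda>x. fi P i (block P i x))" for i
  proof (rule convex_onI)
    fix s :: real and x y assume s: "0 < s" "s < 1"
    have fi: "convex_on (block_space P i) (fi P i)"
      using P by (simp add: convex_problem_def)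
    have "block P i x \<in> block_space P i" for x
      by (simp add: block_space_def block_nth)
    from convex_onD[OF fi, of s, OF _ _ this this, of x y] s
    show "fi P i (block P i ((1 - s) *\<^sub>R x + s *\<^sub>R y))
        \<le> (1 - s) * fi P i (block P i x) + s * fi P i (block P i y)"
      by (simp add: linear_add[OF linear_block] linear_cmul[OF linear_block])
  qed simp
  moreover have "convex_on UNIV (\<lambda>x. \<mu> $ j * constr P x $ j)" for j
    using P \<mu> by (intro convex_on_cmul) (auto simp: convex_problem_def nonneg_orthant_def)
  ultimately show ?thesis
    using P unfolding objective_def inner_vec_def
    by (auto intro!: convex_on_add convex_on_finite_sum simp: convex_problem_def)
qed

text \<open>Adding \<open>a/2\<close> times the squared norm to a convex function makes it strongly convex, so a
  minimiser is beaten by every other point with a quadratic margin. The argument compares the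
  minimiser \<open>x\<close> with points on the segment to \<open>y\<close> and lets them tend to \<open>x\<close>.\<close>

lemma regularised_minimiser_gap:
  fixes h :: "'b::real_inner \<Rightarrow> real"
  assumes h: "convex_on UNIV h" and S: "convex S" and x: "x \<in> S" and y: "y \<in> S"
    and min: "\<And>z. z \<in> S \<Longrightarrow> h x + a / 2 * (norm x)\<^sup>2 \<le> h z + a / 2 * (norm z)\<^sup>2"
  shows "h x + a / 2 * (norm x)\<^sup>2 + a / 2 * (norm (y - x))\<^sup>2 \<le> h y + a / 2 * (norm y)\<^sup>2"
proof -
  define d where "d = h y + a / 2 * (norm y)\<^sup>2 - (h x + a / 2 * (norm x)\<^sup>2)"
  \<comment> \<open>The comparison point at parameter \<open>s\<close> gives the margin only up to the factor
    \<open>r = 1 - s\<close>; the full margin is the limit \<open>r \<longlongrightarrow> 1\<close>.\<close>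
  have "r * (a / 2 * (norm (y - x))\<^sup>2) \<le> d" if r: "0 < r" "r < 1" for r
  proof -
    define s where "s = 1 - r"
    have s: "0 < s" "s < 1" using r by (auto simp: s_def)
    define u where "u = (1 - s) *\<^sub>R x + s *\<^sub>R y"
    have "u \<in> S"
      unfolding u_def using S x y s by (intro convexD) auto
    then have "h x + a / 2 * (norm x)\<^sup>2 \<le> h u + a / 2 * (norm u)\<^sup>2"
      by (rule min)
    also have "h u \<le> (1 - s) * h x + s * h y"
      unfolding u_def using h s by (intro convex_onD) auto
    also have "(norm u)\<^sup>2 = (1 - s) * (norm x)\<^sup>2 + s * (norm y)\<^sup>2 - s * (1 - s) * (norm (y - x))\<^sup>2"
      unfolding u_def power2_norm_eq_inner
      by (simp add: inner_simps inner_commute) (simp add: algebra_simps)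
    finally have "0 \<le> s * (d - (1 - s) * (a / 2 * (norm (y - x))\<^sup>2))"
      by (simp add: d_def field_simps)
    then show ?thesis using s by (simp add: zero_le_mult_iff s_def)
  qed
  then have "a / 2 * (norm (y - x))\<^sup>2 \<le> d"
    by (rule field_le_mult_one_interval)
  then show ?thesis by (simp add: d_def)
qed

lemma constr_has_derivative:
  assumes "convex_problem P"
  shows "(constr P has_derivative frechet_derivative (constr P) (at x)) (at x)"
  using assms unfolding convex_problem_def C2_def
  by (meson differentiableI frechet_derivative_works)

text \<open>The supremum that defines \<^const>\<open>M_g\<close> is over a bounded set: the derivative is itself
  differentiable, hence continuous, and the feasible set is compact.\<close>

lemma onorm_le_M_g:
  assumes P: "convex_problem P" and x: "x \<in> X P"
  shows "onorm (frechet_derivative (constr P) (at x)) \<le> M_g P"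
proof -
  obtain F' :: "_ \<Rightarrow> _ \<Rightarrow>\<^sub>L _" and F'' :: "_ \<Rightarrow> _ \<Rightarrow>\<^sub>L _ \<Rightarrow>\<^sub>L _" where
    F': "\<And>x. (constr P has_derivative blinfun_apply (F' x)) (at x)"
    and F'': "\<And>x. (F' has_derivative blinfun_apply (F'' x)) (at x)"
    using P unfolding convex_problem_def C2_def by blast
  have onorm: "onorm (frechet_derivative (constr P) (at z)) = norm (F' z)" for z
    using frechet_derivative_at[OF F', of z] by (simp add: norm_blinfun.rep_eq)
  have "continuous_on (X P) F'"
    using F'' by (meson has_derivative_at_withinI has_derivative_continuous_on)
  then have "compact ((\<lambda>z. norm (F' z)) ` X P)"
    by (intro compact_continuous_image continuous_on_norm compact_X P)
  then have "bdd_above ((\<lambda>z. norm (F' z)) ` X P)"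
    by (intro bounded_imp_bdd_above compact_imp_bounded)
  then show ?thesis
    unfolding M_g_def onorm using x by (intro cSUP_upper)
qed

lemma M_g_nonneg:
  assumes "convex_problem P"
  shows "0 \<le> M_g P"
proof -
  obtain x where "x \<in> X P" using X_nonempty[OF assms] by blast
  have "0 \<le> onorm (frechet_derivative (constr P) (at x))"
    using constr_has_derivative[OF assms] by (intro onorm_pos_le has_derivative_bounded_linear)
  also have "\<dots> \<le> M_g P" using assms \<open>x \<in> X P\<close> by (rule onorm_le_M_g)
  finally show ?thesis .
qed

lemma constr_lipschitz:
  assumes P: "convex_problem P" and "x \<in> X P" "y \<in> X P"
  shows "norm (constr P x - constr P y) \<le> M_g P * norm (x - y)"
  using assms(2,3) onorm_le_M_g[OF P] constr_has_derivative[OF P]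
  by (intro differentiable_bound[OF convex_X[OF P]]) (auto intro: has_derivative_at_withinI)

lemma continuous_on_Lagr:
  assumes "convex_problem P"
  shows "continuous_on S (\<lambda>x. Lagr P x \<mu>)"
  unfolding Lagr_def objective_def using assms
  by (intro continuous_intros C2_continuous) (auto simp: convex_problem_def)

lemma x_hat_minimiser:
  assumes "convex_problem P"
  shows "x_hat P R t \<in> X P" and "\<And>z. z \<in> X P \<Longrightarrow> Lagr P (x_hat P R t) (mu R t) \<le> Lagr P z (mu R t)"
proof -
  obtain x where x: "x \<in> X P" "\<forall>z\<in>X P. Lagr P x (mu R t) \<le> Lagr P z (mu R t)"
    using continuous_attains_inf[OF compact_X X_nonempty continuous_on_Lagr] assms by blast
  then have "is_arg_min (\<lambda>x. Lagr P x (mu R t)) (\<lambda>x. x \<in> X P) x"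
    by (simp add: is_arg_min_linorder)
  then have "is_arg_min (\<lambda>x. Lagr P x (mu R t)) (\<lambda>x. x \<in> X P) (x_hat P R t)"
    unfolding x_hat_def arg_min_on_def arg_min_def by (rule someI)
  then show "x_hat P R t \<in> X P"
    and "\<And>z. z \<in> X P \<Longrightarrow> Lagr P (x_hat P R t) (mu R t) \<le> Lagr P z (mu R t)"
    by (simp_all add: is_arg_min_linorder)
qed

text \<open>Each of the two minimisers beats the other one by a quadratic margin, for its own
  multiplier. In the sum of the two inequalities everything that is independent of the multiplier
  cancels, and so do the terms quadratic in the multiplier.\<close>

lemma minimiser_sensitivity:
  assumes P: "convex_problem P" and \<alpha>: "0 < alpha P"
    and \<mu>: "\<mu> \<in> nonneg_orthant" and \<nu>: "\<nu> \<in> nonneg_orthant"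
    and x: "x \<in> X P" "\<And>z. z \<in> X P \<Longrightarrow> Lagr P x \<mu> \<le> Lagr P z \<mu>"
    and y: "y \<in> X P" "\<And>z. z \<in> X P \<Longrightarrow> Lagr P y \<nu> \<le> Lagr P z \<nu>"
  shows "norm (x - y) \<le> M_g P / alpha P * norm (\<mu> - \<nu>)"
proof (cases "x = y")
  case True
  then show ?thesis using M_g_nonneg[OF P] \<alpha> by simp
next
  case False
  have gap: "Lagr P a \<xi> + alpha P / 2 * (norm (b - a))\<^sup>2 \<le> Lagr P b \<xi>"
    if \<xi>: "\<xi> \<in> nonneg_orthant" and a: "a \<in> X P" "\<And>z. z \<in> X P \<Longrightarrow> Lagr P a \<xi> \<le> Lagr P z \<xi>"
      and b: "b \<in> X P" for a b \<xi>
    using regularised_minimiser_gap[OF convex_on_objective_plus_constraints[OF P \<xi>] convex_X[OF P]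
        a(1) b, of "alpha P"] a(2)
    by (simp add: Lagr_def algebra_simps)
  have "alpha P * (norm (x - y))\<^sup>2 \<le> (\<mu> - \<nu>) \<bullet> (constr P y - constr P x)"
    using gap[OF \<mu> x y(1)] gap[OF \<nu> y x(1)]
    by (simp add: Lagr_def inner_simps norm_minus_commute)
  also have "\<dots> \<le> norm (\<mu> - \<nu>) * norm (constr P y - constr P x)"
    by (rule norm_cauchy_schwarz)
  also have "\<dots> \<le> norm (\<mu> - \<nu>) * (M_g P * norm (x - y))"
    using constr_lipschitz[OF P y(1) x(1)] by (intro mult_left_mono) (auto simp: norm_minus_commute)
  finally have "norm (x - y) * (alpha P * norm (x - y)) \<le> norm (x - y) * (M_g P * norm (\<mu> - \<nu>))"
    by (simp add: power2_eq_square mult_ac)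
  then have "alpha P * norm (x - y) \<le> M_g P * norm (\<mu> - \<nu>)"
    using False by simp
  then show ?thesis using \<alpha> by (simp add: field_simps)
qed

section \<open>The blocks held by the agents\<close>

text \<open>\<^const>\<open>ess_nbrs\<close> speaks about points that differ in a single block. Points that differ in
  several irrelevant blocks are connected by exchanging these blocks one at a time.\<close>

lemma block_grad_cong:
  assumes \<mu>: "\<mu> \<in> nonneg_orthant"
    and eq: "\<And>j. j = i \<or> i \<in> ess_nbrs P j \<Longrightarrow> block P j x = block P j y"
  shows "block P i (grad_Lagr P x \<mu>) = block P i (grad_Lagr P y \<mu>)"
proof -
  define w where "w A = (\<Sum>j\<in>UNIV. block P j (if j \<in> A then y else x))" for A
  have block_w: "block P j (w A) = block P j (if j \<in> A then y else x)" for j A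
    unfolding w_def by (rule block_glue)
  define B where "B = {j. block P j x \<noteq> block P j y}"
  have "block P i (grad_Lagr P (w A) \<mu>) = block P i (grad_Lagr P x \<mu>)" if "A \<subseteq> B" for A
    using finite[of A] that
  proof (induction A)
    case empty
    have "w {} = x" by (rule block_eqI[of P]) (simp add: block_w)
    then show ?case by simp
  next
    case (insert j A)
    then have "j \<noteq> i" "i \<notin> ess_nbrs P j" using eq by (auto simp: B_def)
    moreover have "\<forall>l. l \<noteq> j \<longrightarrow> block P l (w (insert j A)) = block P l (w A)"
      by (simp add: block_w)
    ultimately have "block P i (grad_Lagr P (w (insert j A)) \<mu>) = block P i (grad_Lagr P (w A) \<mu>)"
      using \<mu> unfolding ess_nbrs_def by blast
    then show ?case using insert by simp
  qed
  from this[of B] have "block P i (grad_Lagr P (w B) \<mu>) = block P i (grad_Lagr P x \<mu>)" by simp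
  moreover have "w B = y"
    by (rule block_eqI[of P]) (auto simp: block_w B_def)
  ultimately show ?thesis by simp
qed

lemma primal_step_cong:
  assumes "\<mu> \<in> nonneg_orthant"
    and "\<And>j. j = i \<or> i \<in> ess_nbrs P j \<Longrightarrow> block P j x = block P j y"
  shows "primal_step P \<gamma> i x \<mu> = primal_step P \<gamma> i y \<mu>"
  unfolding primal_step_def using block_grad_cong[OF assms] assms(2)[of i] by simp

text \<open>The update rule for own blocks is stated for each dual vector separately. To use it at an
  arbitrary time, one needs that some dual vector is onboard.\<close>

lemma in_phase:
  assumes "communication P R"
  obtains t where "kt R t \<le> k" "k < kt R (Suc t)"
proof -
  have kt: "strict_mono (kt R)" "kt R 0 = 0"
    using assms by (simp_all add: communication_def)
  have "\<exists>t. kt R t \<le> k \<and> k < kt R (Suc t)"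
  proof (induction k)
    case 0
    have "kt R 0 < kt R (Suc 0)" using kt(1) by (simp add: strict_mono_Suc_iff)
    with kt(2) show ?case by (intro exI[of _ 0]) simp
  next
    case (Suc k)
    then obtain t where t: "kt R t \<le> k" "k < kt R (Suc t)" by blast
    have "kt R (Suc t) < kt R (Suc (Suc t))" using kt(1) by (simp add: strict_mono_Suc_iff)
    with t show ?case by (cases "Suc k < kt R (Suc t)") (auto intro: exI[of _ t] exI[of _ "Suc t"])
  qed
  with that show ?thesis by blast
qed

lemma own_block_Suc:
  assumes "iterates P R" "kt R t \<le> k" "k < kt R (Suc t)"
  shows "block P i (st R i (Suc k)) =
    (if k \<in> upd R i then primal_step P (gam R) i (st R i k) (mu R t) else block P i (st R i k))"
  using assms unfolding iterates_def by blast

lemma own_block_idle: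
  assumes "async_run P R" "k \<notin> upd R i"
  shows "block P i (st R i (Suc k)) = block P i (st R i k)"
proof -
  have "communication P R" "iterates P R" using assms(1) by (simp_all add: async_run_def)
  then show ?thesis using own_block_Suc assms(2) in_phase by metis
qed

lemma comp_time_0: "comp_time R i 0 = 0"
  by (simp add: comp_time_def)

lemma comp_time_Suc: "comp_time R i (Suc k) = (if k \<in> upd R i then Suc k else comp_time R i k)"
proof -
  have fin: "finite {Suc l |l. l \<in> upd R i \<and> l < k}"
    by (rule finite_surj[of "{..<k}" _ Suc]) auto
  show ?thesis
  proof (cases "k \<in> upd R i")
    case True
    then have "{Suc l |l. l \<in> upd R i \<and> l < Suc k} = insert (Suc k) {Suc l |l. l \<in> upd R i \<and> l < k}"
      by (auto simp: less_Suc_eq)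
    then have "comp_time R i (Suc k) = Max (insert (Suc k) (insert 0 {Suc l |l. l \<in> upd R i \<and> l < k}))"
      by (simp add: comp_time_def insert_commute)
    also have "\<dots> = Suc k"
      using fin by (intro Max_eqI) auto
    finally show ?thesis using True by simp
  next
    case False
    then have "{Suc l |l. l \<in> upd R i \<and> l < Suc k} = {Suc l |l. l \<in> upd R i \<and> l < k}"
      by (auto simp: less_Suc_eq)
    then show ?thesis using False by (simp add: comp_time_def)
  qed
qed

lemma comp_time_le: "comp_time R i k \<le> k"
  by (induction k) (auto simp: comp_time_0 comp_time_Suc)

text \<open>An own block does not change between the time at which it was computed and the next update,
  so computation times and sending times are interchangeable as far as values are concerned.\<close>

lemma own_block_comp_time:
  assumes "async_run P R"
  shows "block P i (st R i (comp_time R i k)) = block P i (st R i k)"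
  by (induction k) (auto simp: comp_time_0 comp_time_Suc own_block_idle[OF assms])

text \<open>Unlike \<^const>\<open>tau\<close>, this is a sending time and not a computation time: whether a message
  belongs to the current dual vector, or follows a given update, depends on when it was
  sent.\<close>

definition last_sent :: "('n::finite, 'm::finite, 'a::finite) run \<Rightarrow> 'a \<Rightarrow> 'a \<Rightarrow> nat \<Rightarrow> nat" where
  "last_sent R i j k = Max (insert 0 {s. \<exists>r\<le>k. used R j i s r})"

lemma used_imp_le:
  assumes "communication P R" "used R j i s r"
  shows "s \<le> r"
  using assms unfolding communication_def ordered_transmissions_def used_def by fastforce

lemma finite_used:
  assumes "communication P R"
  shows "finite {s. \<exists>r\<le>k. used R j i s r}"
  by (rule finite_subset[of _ "{..k}"]) (auto dest: used_imp_le[OF assms])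

lemma last_sent_le:
  assumes "communication P R"
  shows "last_sent R i j k \<le> k"
proof -
  have "last_sent R i j k \<in> insert 0 {s. \<exists>r\<le>k. used R j i s r}"
    unfolding last_sent_def by (intro Max_in finite.insertI finite_used[OF assms]) simp
  then show ?thesis using used_imp_le[OF assms] by fastforce
qed

lemma le_last_sent:
  assumes "communication P R" "used R j i s r" "r \<le> k"
  shows "s \<le> last_sent R i j k"
  unfolding last_sent_def
  by (intro Max_ge finite.insertI finite_used[OF assms(1)]) (use assms(2,3) in blast)

text \<open>At every time, not only upon reception, the copy of a foreign block is an own block of its
  owner at an earlier time. In the absence of any message the sending time is \<open>0\<close>, which fits
  because all agents start from the same vector.\<close>

lemma held_block:
  assumes run: "async_run P R" and "j \<noteq> i"
  shows "block P j (st R i k) = block P j (st R j (last_sent R i j k))"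
proof -
  have com: "communication P R" and it: "iterates P R"
    using run by (simp_all add: async_run_def)
  show ?thesis
  proof (induction k)
    case 0
    have "last_sent R i j 0 = 0"
      using last_sent_le[OF com, of i j 0] by simp
    moreover have "st R i 0 = st R j 0" using it by (auto simp: iterates_def)
    ultimately show ?case by simp
  next
    case (Suc k)
    have Suc_k: "block P j (st R i (Suc k)) =
          (if \<exists>s. used R j i s (Suc k) then block P j (st R j (tau R i j (Suc k)))
           else block P j (st R i k))"
      using it \<open>j \<noteq> i\<close> unfolding iterates_def by blast
    show ?case
    proof (cases "\<exists>s. used R j i s (Suc k)")
      case True
      have "tau R i j (Suc k) = comp_time R j (last_sent R i j (Suc k))"
        by (simp add: tau_def last_sent_def)
      with True Suc_k show ?thesis by (simp add: own_block_comp_time[OF run])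
    next
      case False
      then have "last_sent R i j (Suc k) = last_sent R i j k"
        unfolding last_sent_def by (metis (no_types, lifting) le_Suc_eq)
      with False Suc_k Suc.IH show ?thesis by simp
    qed
  qed
qed

lemma own_block_in_Xi:
  assumes P: "convex_problem P" and run: "async_run P R"
  shows "block P i (st R i k) \<in> Xi P i"
proof -
  have com: "communication P R" and it: "iterates P R"
    using run by (simp_all add: async_run_def)
  show ?thesis
  proof (induction k)
    case 0
    have "st R i 0 \<in> X P" using it unfolding iterates_def by metis
    then show ?case by (simp add: X_def block_product_def)
  next
    case (Suc k)
    obtain t where t: "kt R t \<le> k" "k < kt R (Suc t)" using in_phase[OF com] .
    have "closed (Xi P i)" "Xi P i \<noteq> {}"
      using P by (auto simp: convex_problem_def compact_imp_closed)
    then show ?case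
      using Suc unfolding own_block_Suc[OF it t] by (simp add: primal_step_def closest_point_in_set)
  qed
qed

lemma st_in_X:
  assumes "convex_problem P" "async_run P R"
  shows "st R i k \<in> X P"
proof -
  have "block P j (st R i k) \<in> Xi P j" for j
    using own_block_in_Xi[OF assms] held_block[OF assms(2)] by (cases "j = i") metis+
  then show ?thesis by (simp add: X_def block_product_def)
qed

section \<open>Contraction over one cycle\<close>

lemma D_max_nonneg: "0 \<le> D_max P R t"
  unfolding D_max_def by (subst Max_ge_iff) (auto simp: norm_2inf_nonneg)

lemma q_p_nonneg: "0 \<le> q_p P \<gamma>"
  by (simp add: q_p_def)

lemma x_hat_in_Xset:
  assumes "convex_problem P"
  shows "x_hat P R t \<in> Xset P R t s"
proof -
  have "norm_2inf P 0 \<le> 0"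
    by (rule norm_2inf_leI) (simp add: linear_0[OF linear_block])
  also have "0 \<le> q_p P (gam R) ^ s * D_max P R t"
    by (simp add: D_max_nonneg q_p_nonneg)
  finally show ?thesis by (simp add: Xset_def x_hat_minimiser[OF assms])
qed

text \<open>The contraction hypothesis only says that the products of the factors are nested. As every
  product contains the minimiser, changing one block of the minimiser shows that the factors are
  nested, too.\<close>

lemma contracting_boxes:
  assumes P: "convex_problem P" and "contracting_sets P R t"
  obtains Y where "\<And>s. Xset P R t s = block_product P (Y s)"
    and "\<And>s i. block P i (x_hat P R t) \<in> Y s i"
    and "\<And>s i. Y (Suc s) i \<subseteq> Y s i"
    and "\<And>s y i. y \<in> Xset P R t s \<Longrightarrow> primal_step P (gam R) i y (mu R t) \<in> Y (Suc s) i"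
proof -
  obtain Y where Xi: "\<And>s i. Y s i \<subseteq> Xi P i"
    and box: "\<And>s. Xset P R t s = block_product P (Y s)"
    and step: "\<And>s y i. y \<in> Xset P R t s \<Longrightarrow> primal_step P (gam R) i y (mu R t) \<in> Y (Suc s) i"
    and decr: "\<And>s. Xset P R t (Suc s) \<subseteq> Xset P R t s"
    using assms(2) unfolding contracting_sets_def by metis
  have hat: "block P i (x_hat P R t) \<in> Y s i" for s i
    using x_hat_in_Xset[OF P, of R t s] unfolding box by (simp add: block_product_def)
  have "v \<in> Y s i" if v: "v \<in> Y (Suc s) i" for s i v
  proof -
    have "v \<in> block_space P i"
      using v Xi P unfolding convex_problem_def by blast
    then have id: "block P i v = v" by (rule block_of_block_space)
    define w where "w = (\<Sum>j\<in>UNIV. block P j (if j = i then v else x_hat P R t))"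
    have block_w: "block P j w = block P j (if j = i then v else x_hat P R t)" for j
      unfolding w_def by (rule block_glue)
    have "w \<in> Xset P R t (Suc s)"
      unfolding box block_product_def using v hat id by (simp add: block_w)
    then have "w \<in> block_product P (Y s)" using decr box by blast
    then have "block P i w \<in> Y s i" by (simp add: block_product_def)
    then show ?thesis by (simp add: block_w id)
  qed
  then show ?thesis using that box hat step by blast
qed

text \<open>From here on \<open>Y s\<close> stands for the factors of the \<open>s\<close>-th box.\<close>

context
  fixes P :: "('n::finite, 'm::finite, 'a::finite) problem"
    and R :: "('n, 'm, 'a) run" and t :: nat
    and Y :: "nat \<Rightarrow> 'a \<Rightarrow> (real ^ 'n) set"
  assumes P: "convex_problem P" and run: "async_run P R"
    and box: "\<And>s. Xset P R t s = block_product P (Y s)"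
    and hat: "\<And>s i. block P i (x_hat P R t) \<in> Y s i"
    and decr: "\<And>s i. Y (Suc s) i \<subseteq> Y s i"
    and step: "\<And>s y i. y \<in> Xset P R t s \<Longrightarrow> primal_step P (gam R) i y (mu R t) \<in> Y (Suc s) i"
begin

text \<open>The invariant of the asynchronous iteration. Own blocks are controlled up to and including
  the time \<^term>\<open>kt R (Suc t)\<close>, since the last update with \<^term>\<open>mu R t\<close> onboard takes effect
  at that time and may be the one that reaches the cloud. Foreign blocks are controlled only
  strictly before it, since a message under way when the next dual vector arrives is
  discarded; an update at that time uses the next dual vector already.\<close>

definition settled :: "nat \<Rightarrow> nat \<Rightarrow> bool" where
  "settled s a \<longleftrightarrow>
     (\<forall>i k. a \<le> k \<and> k \<le> kt R (Suc t) \<longrightarrow> block P i (st R i k) \<in> Y s i) \<and>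
     (\<forall>i j k. a \<le> k \<and> k < kt R (Suc t) \<and> i \<in> ess_nbrs P j \<longrightarrow> block P j (st R i k) \<in> Y s j)"

lemma settled_own: "settled s a \<Longrightarrow> a \<le> k \<Longrightarrow> k \<le> kt R (Suc t) \<Longrightarrow> block P i (st R i k) \<in> Y s i"
  by (simp add: settled_def)

text \<open>It suffices that the blocks entering the partial gradient lie in the box. The remaining ones
  are replaced by those of the minimiser, which lie in every box.\<close>

lemma primal_step_box:
  assumes "\<And>j. j = i \<or> i \<in> ess_nbrs P j \<Longrightarrow> block P j y \<in> Y s j"
  shows "primal_step P (gam R) i y (mu R t) \<in> Y (Suc s) i"
proof -
  have \<mu>: "mu R t \<in> nonneg_orthant"
    using run mu_nonneg[of P R t] by (simp add: async_run_def)
  define w where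
    "w = (\<Sum>j\<in>UNIV. block P j (if j = i \<or> i \<in> ess_nbrs P j then y else x_hat P R t))"
  have block_w: "block P j w = block P j (if j = i \<or> i \<in> ess_nbrs P j then y else x_hat P R t)" for j
    unfolding w_def by (rule block_glue)
  have "w \<in> Xset P R t s"
    unfolding box block_product_def using assms hat by (simp add: block_w)
  then have "primal_step P (gam R) i w (mu R t) \<in> Y (Suc s) i" by (rule step)
  moreover have "primal_step P (gam R) i y (mu R t) = primal_step P (gam R) i w (mu R t)"
    by (rule primal_step_cong[OF \<mu>]) (auto simp: block_w)
  ultimately show ?thesis by simp
qed

lemma used_in_phase:
  assumes "used R j i s r" "kt R t < r" "r < kt R (Suc t)"
  shows "kt R t \<le> s"
proof -
  have mono: "strict_mono (kt R)" using run by (simp add: async_run_def communication_def)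
  obtain t' where "kt R t' \<le> s" "r < kt R (Suc t')" using assms(1) by (auto simp: used_def)
  then have "kt R t < kt R (Suc t')" using assms(2) by simp
  then have "t \<le> t'" using strict_mono_less[OF mono, of t "Suc t'"] by simp
  then have "kt R t \<le> kt R t'" using mono by (simp add: strict_mono_less_eq)
  then show "kt R t \<le> s" using \<open>kt R t' \<le> s\<close> by simp
qed

text \<open>When the dual vector arrives, all blocks held by any agent are in box \<open>0\<close>, as its radius is
  their largest distance from the minimiser. Updates preserve this, and messages preserve it
  because only those sent since the dual vector arrived are used. Blocks computed with earlier multipliers are covered
  because they count in the radius of box \<open>0\<close> as long as an agent still holds them.\<close>

lemma settled_start: "settled 0 (kt R t)"
proof -
  have com: "communication P R" and it: "iterates P R"
    using run by (simp_all add: async_run_def)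
  have start: "block P j (st R i (kt R t)) \<in> Y 0 j" for i j
  proof -
    have "norm_2inf P (st R i (kt R t) - x_hat P R t) \<le> D_max P R t"
      unfolding D_max_def by (rule Max_ge) auto
    then have "st R i (kt R t) \<in> Xset P R t 0"
      by (simp add: Xset_def st_in_X[OF P run])
    then show ?thesis unfolding box by (simp add: block_product_def)
  qed
  have inv: "(\<forall>i. block P i (st R i k) \<in> Y 0 i) \<and>
      (k < kt R (Suc t) \<longrightarrow> (\<forall>i j. block P j (st R i k) \<in> Y 0 j))"
    if "kt R t \<le> k" "k \<le> kt R (Suc t)" for k
    using that
  proof (induction k rule: less_induct)
    case (less k)
    show ?case
    proof (cases "k = kt R t")
      case True
      then show ?thesis using start by simp
    next
      case False
      then obtain l where l: "k = Suc l" "kt R t \<le> l" "l < kt R (Suc t)"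
        using less.prems by (cases k) auto
      have held: "block P j (st R i l) \<in> Y 0 j" for i j
        using less.IH[of l] l by simp
      have own: "block P i (st R i k) \<in> Y 0 i" for i
        unfolding l(1) own_block_Suc[OF it l(2,3)]
        using held primal_step_box[of i "st R i l" 0] decr[of 0 i] by auto
      have "block P j (st R i k) \<in> Y 0 j" if k: "k < kt R (Suc t)" and "j \<noteq> i" for i j
      proof (cases "\<exists>s. used R j i s k")
        case True
        then obtain s where s: "used R j i s k" by blast
        have "kt R t \<le> s" using used_in_phase[OF s] l k by simp
        also have "s \<le> last_sent R i j k" using le_last_sent[OF com s] by simp
        finally have "kt R t \<le> last_sent R i j k" .
        moreover have "last_sent R i j k \<le> k" by (rule last_sent_le[OF com])
        ultimately show ?thesis
          unfolding held_block[OF run \<open>j \<noteq> i\<close>]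
          using less.IH[of "last_sent R i j k"] k own by (cases "last_sent R i j k = k") auto
      next
        case False
        then have "block P j (st R i k) = block P j (st R i l)"
          using it \<open>j \<noteq> i\<close> unfolding iterates_def l(1) by auto
        then show ?thesis using held by simp
      qed
      with own show ?thesis by metis
    qed
  qed
  show ?thesis unfolding settled_def using inv by fastforce
qed

text \<open>The first update after time \<open>a\<close> moves the own block into the next box. Later updates may
  again use blocks that are only known to be in the old box, but this is enough for them to
  land in the next one.\<close>

lemma own_block_contracts:
  assumes settled: "settled s a" and "kt R t \<le> a" and k: "k \<in> upd R i" "a \<le> k"
    and "Suc k \<le> k'" "k' \<le> kt R (Suc t)"
  shows "block P i (st R i k') \<in> Y (Suc s) i"
proof -
  have it: "iterates P R" using run by (simp add: async_run_def)
  have upd: "primal_step P (gam R) i (st R i l) (mu R t) \<in> Y (Suc s) i"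
    if "a \<le> l" "l < kt R (Suc t)" for l
    using settled that by (intro primal_step_box) (auto simp: settled_def)
  from \<open>Suc k \<le> k'\<close> \<open>k' \<le> kt R (Suc t)\<close> show ?thesis
  proof (induction k' rule: dec_induct)
    case base
    then show ?case
      using own_block_Suc[OF it, of t k i] upd[of k] k \<open>kt R t \<le> a\<close> by simp
  next
    case (step l)
    then show ?case
      using own_block_Suc[OF it, of t l i] upd[of l] k \<open>kt R t \<le> a\<close> by simp
  qed
qed

text \<open>By the end of a cycle every agent has updated its own block and has received, from each agent
  on which it depends, a block computed after the start of the cycle. Blocks sent still later
  stem from the same or from later updates, so they are in the new box as well.\<close>

lemma settled_cycle:
  assumes settled: "settled s a" and a: "kt R t \<le> a"
    and cycle: "cycle_met P R a e"
  shows "settled (Suc s) e"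
proof -
  have com: "communication P R" using run by (simp add: async_run_def)
  have own: "block P i (st R i k) \<in> Y (Suc s) i" if "e \<le> k" "k \<le> kt R (Suc t)" for i k
  proof -
    obtain l where l: "l \<in> upd R i" "a \<le> l" "Suc l \<le> e"
      using cycle unfolding cycle_met_def by metis
    show ?thesis using own_block_contracts[OF settled a l(1,2)] l(3) that by simp
  qed
  moreover have "block P j (st R i k) \<in> Y (Suc s) j"
    if k: "e \<le> k" "k < kt R (Suc t)" and "i \<in> ess_nbrs P j" for i j k
  proof -
    obtain l sent r where l: "l \<in> upd R j" "a \<le> l" and tx: "(sent, r) \<in> tx R j i"
      and comp: "comp_time R j sent = Suc l" and r: "r \<le> e"
      using cycle \<open>i \<in> ess_nbrs P j\<close> unfolding cycle_met_def by blast
    have "j \<noteq> i" using \<open>i \<in> ess_nbrs P j\<close> by (auto simp: ess_nbrs_def)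
    have sent: "Suc l \<le> sent" using comp_time_le[of R j sent] comp by simp
    have "used R j i sent r"
      unfolding used_def using tx sent l a r k by (auto intro!: exI[of _ t])
    then have "sent \<le> last_sent R i j k"
      using le_last_sent[OF com] r k by simp
    moreover have "last_sent R i j k \<le> k" by (rule last_sent_le[OF com])
    ultimately show ?thesis
      unfolding held_block[OF run \<open>j \<noteq> i\<close>]
      using sent k by (intro own_block_contracts[OF settled a l]) simp_all
  qed
  ultimately show ?thesis unfolding settled_def by blast
qed

lemma settled_cycle_end:
  assumes "cycle_end P R t n e"
  shows "kt R t \<le> e \<and> settled n e"
  using assms
proof induction
  case start
  show ?case using settled_start by simp
next
  case (step n a e)
  obtain k where "a \<le> k" "Suc k \<le> e"
    using \<open>cycle_met P R a e\<close> unfolding cycle_met_def by blast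
  then show ?case using step.IH settled_cycle[OF _ _ \<open>cycle_met P R a e\<close>] by auto
qed

end

section \<open>Counting cycles\<close>

lemma cycle_met_imp_less: "cycle_met P R a e \<Longrightarrow> a < e"
  unfolding cycle_met_def by (meson Suc_le_eq le_less_trans)

lemma cycle_end_ge: "cycle_end P R t n e \<Longrightarrow> kt R t + n \<le> e"
  by (induction rule: cycle_end.induct) (auto dest: cycle_met_imp_less)

text \<open>\<^const>\<open>cycles\<close> is the cardinality of a set of indices. Cycles end in strictly increasing
  order, so this set is an initial segment of the positive numbers, and its cardinality is
  the index of the last completed cycle.\<close>

lemma cycle_end_cycles:
  assumes m: "m = (MIN i. cloud_send R i t)" "kt R t \<le> m"
  shows "\<exists>e\<le>m. cycle_end P R t (cycles P R t) e"
proof -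
  define C where "C = {n. \<exists>e\<le>m. cycle_end P R t n e}"
  have down: "n \<in> C" if n: "Suc n \<in> C" for n
  proof -
    obtain e where "e \<le> m" "cycle_end P R t (Suc n) e" using n by (auto simp: C_def)
    then obtain a where "cycle_end P R t n a" "cycle_met P R a e" by (auto elim: cycle_end.cases)
    then show ?thesis
      using cycle_met_imp_less[of P R a e] \<open>e \<le> m\<close> unfolding C_def by (auto intro!: exI[of _ a])
  qed
  have "finite C"
    by (rule finite_subset[of _ "{..m}"]) (auto simp: C_def dest: cycle_end_ge)
  have "0 \<in> C" using m(2) cycle_end.start by (auto simp: C_def)
  define c where "c = Max C"
  have "c \<in> C" unfolding c_def using \<open>finite C\<close> \<open>0 \<in> C\<close> by (intro Max_in) auto
  have "{n. 1 \<le> n \<and> n \<in> C} = {1..c}"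
  proof (intro set_eqI iffI)
    fix n assume "n \<in> {1..c}"
    then have "n \<le> c" by simp
    then have "n \<in> C"
      by (induction rule: inc_induct) (use \<open>c \<in> C\<close> down in auto)
    then show "n \<in> {n. 1 \<le> n \<and> n \<in> C}" using \<open>n \<in> {1..c}\<close> by simp
  qed (use \<open>finite C\<close> in \<open>auto simp: c_def\<close>)
  then have "cycles P R t = c"
    unfolding cycles_def m(1)[symmetric] by (simp add: C_def)
  then show ?thesis using \<open>c \<in> C\<close> by (simp add: C_def)
qed

text \<open>The state used by the cloud for the next dual vector was sent while \<^term>\<open>mu R t\<close> was
  onboard, or at the very moment of its replacement.\<close>

lemma cloud_send_bounds:
  assumes "communication P R"
  shows "kt R t < cloud_send R i t" and "cloud_send R i t \<le> kt R (Suc t)"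
proof -
  define A where "A = {s. \<exists>r\<le>ct R t. (s, r) \<in> ctx R i}"
  have le: "s \<le> ct R t" if "s \<in> A" for s
    using that assms unfolding A_def communication_def ordered_transmissions_def by fastforce
  then have fin: "finite A" by (meson atMost_iff finite_atMost finite_subset subsetI)
  obtain s r where "(s, r) \<in> ctx R i" "r \<le> ct R t" and s: "kt R t < comp_time R i s"
    using assms unfolding communication_def by blast
  then have "s \<in> A" by (auto simp: A_def)
  have cs: "cloud_send R i t = Max A" by (simp add: cloud_send_def A_def)
  have "kt R t < s" using s comp_time_le[of R i s] by simp
  also have "s \<le> Max A" using fin \<open>s \<in> A\<close> by simp
  finally show "kt R t < cloud_send R i t" unfolding cs .
  have "Max A \<in> A" using fin \<open>s \<in> A\<close> by (intro Max_in) auto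
  then have "Max A \<le> ct R t" by (rule le)
  also have "\<dots> \<le> kt R (Suc t)" using assms by (simp add: communication_def)
  finally show "cloud_send R i t \<le> kt R (Suc t)" unfolding cs .
qed

section \<open>The aggregated vector\<close>

lemma x_c_in_Xset:
  assumes P: "convex_problem P" and run: "async_run P R" and contr: "contracting_sets P R t"
  shows "x_c P R t \<in> Xset P R t (cycles P R t)"
proof -
  have com: "communication P R" using run by (simp add: async_run_def)
  obtain Y where Y: "\<And>s. Xset P R t s = block_product P (Y s)"
    "\<And>s i. block P i (x_hat P R t) \<in> Y s i" "\<And>s i. Y (Suc s) i \<subseteq> Y s i"
    "\<And>s y i. y \<in> Xset P R t s \<Longrightarrow> primal_step P (gam R) i y (mu R t) \<in> Y (Suc s) i"
    using contracting_boxes[OF P contr] by blast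
  define m where "m = (MIN i. cloud_send R i t)"
  have "kt R t \<le> m"
    unfolding m_def using cloud_send_bounds(1)[OF com] by (simp add: less_imp_le)
  then obtain e where "e \<le> m" and e: "cycle_end P R t (cycles P R t) e"
    using cycle_end_cycles[OF m_def] by blast
  have "block P i (x_c P R t) \<in> Y (cycles P R t) i" for i
  proof -
    have "block P i (x_c P R t) = block P i (st R i (cloud_send R i t))"
      unfolding x_c_def block_glue tau_c_def by (rule own_block_comp_time[OF run])
    moreover have "m \<le> cloud_send R i t" unfolding m_def by simp
    then have "e \<le> cloud_send R i t" using \<open>e \<le> m\<close> by simp
    ultimately show ?thesis
      using settled_own[OF P run Y _ _ cloud_send_bounds(2)[OF com]] settled_cycle_end[OF P run Y e]
      by metis
  qed
  then show ?thesis unfolding Y(1) block_product_def by blast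
qed

text \<open>Both the blocks held by the agents and those of the minimiser are feasible, so their
  distance is at most the diameter of the respective factor of the feasible set.\<close>

lemma D_max_le_L_x:
  assumes P: "convex_problem P" and run: "async_run P R"
  shows "D_max P R t \<le> L_x P"
proof -
  have "norm (block P j (st R i k - x_hat P R t)) \<le> L_x P" for i j k
  proof -
    have "block P j (st R i k) \<in> Xi P j" "block P j (x_hat P R t) \<in> Xi P j"
      using st_in_X[OF P run] x_hat_minimiser(1)[OF P] by (auto simp: X_def block_product_def)
    moreover have "bounded (Xi P j)" using P by (simp add: convex_problem_def compact_imp_bounded)
    ultimately have "dist (block P j (st R i k)) (block P j (x_hat P R t)) \<le> diameter (Xi P j)"
      by (intro diameter_bounded_bound)
    also have "\<dots> \<le> L_x P" unfolding L_x_def by (rule Max_ge) auto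
    finally show ?thesis by (simp add: block_diff dist_norm)
  qed
  then show ?thesis
    unfolding D_max_def by (subst Max_le_iff) (auto intro: norm_2inf_leI)
qed

theorem theorem2:
  fixes P :: "('n::finite, 'm::finite, 'a::finite) problem"
    and R :: "('n, 'm, 'a) run"
    and x_kappa :: "real ^ 'n" and mu_kappa :: "real ^ 'm"
    and t :: nat
  assumes "convex_problem P"
    and "0 < alpha P" and "alpha P < L_p P" and "0 < beta P"
    and "saddle_point P x_kappa mu_kappa"
    and "async_run P R"
    and "\<And>t'. contracting_sets P R t'"
    and "0 < gam R" and "gam R < 2 / L_p P"
  shows "norm (x_c P R t - x_kappa)
    \<le> q_p P (gam R) ^ cycles P R t * sqrt (real CARD('a)) * L_x P
      + M_g P / alpha P * norm (mu R t - mu_kappa)"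
proof -
  let ?c = "q_p P (gam R) ^ cycles P R t"
  have "norm_2inf P (x_c P R t - x_hat P R t) \<le> ?c * D_max P R t"
    using x_c_in_Xset[OF assms(1,6,7)] by (simp add: Xset_def)
  also have "\<dots> \<le> ?c * L_x P"
    using D_max_le_L_x[OF assms(1,6)] by (simp add: mult_left_mono q_p_nonneg)
  finally have "norm_2inf P (x_c P R t - x_hat P R t) \<le> ?c * L_x P" .
  then have "sqrt (real CARD('a)) * norm_2inf P (x_c P R t - x_hat P R t)
      \<le> sqrt (real CARD('a)) * (?c * L_x P)"
    by (rule mult_left_mono) simp
  then have cloud: "norm (x_c P R t - x_hat P R t) \<le> ?c * sqrt (real CARD('a)) * L_x P"
    using order_trans[OF norm_le_norm_2inf[of "x_c P R t - x_hat P R t" P]]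
    by (metis mult.assoc mult.commute)
  have "norm (x_hat P R t - x_kappa) \<le> M_g P / alpha P * norm (mu R t - mu_kappa)"
    using assms(5,6) mu_nonneg[of P R t]
    by (intro minimiser_sensitivity[OF assms(1,2)] x_hat_minimiser[OF assms(1)])
       (auto simp: saddle_point_def async_run_def)
  with cloud show ?thesis
    using norm_triangle_ineq[of "x_c P R t - x_hat P R t" "x_hat P R t - x_kappa"] by simp
qed

end
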